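(* Let $(a_t)_{t=1}^\infty$ and $(b_t)_{t=1}^\infty$ be arbitrary sequences of positive real numbers which diverge to infinity and which satisfy $\lim_{t\to\infty} a_t/t=\lim_{t\to\infty} b_t/t=0$. Let $\lambda\in(-1,1)$ be arbitrary. Then there exists a dense $G_\delta$ set $\Omega\subset[0,2\pi]$ with the following property. For every $\theta\in\Omega$ there exists a vector subspace $W\subseteq\mathbb{R}^4$ of dimension at most three such that for every $(u_1,u_2,v_1,v_2)\in\mathbb{R}^4$ the pair of matrices $\mathsf{A}=\{A_0,A_1\}$ defined by \[A_0:=\begin{pmatrix}\lambda&0&u_1\\0&-1&u_2\\0&0&1\end{pmatrix},\qquad A_1:=\begin{pmatrix}\cos\theta&-\sin\theta&v_1\\\sin\theta&\cos\theta&v_2\\0&0&1\end{pmatrix}\] satisfies $\varrho(\mathsf{A})=1$ and satisfies \[\lim_{t\to\infty}\frac1t\max_{i_1,\ldots,i_t\in\{0,1\}}\|A_{i_t}\cdots A_{i_1}\|=0\] and \[\liminf_{t\to\infty}\frac1{a_t}\max_{i_1,\ldots,i_t\in\{0,1\}}\|A_{i_t}\cdots A_{i_1}\|=0,\] and such that if $(u_1,u_2,v_1,v_2)\in\mathbb{R}^4\setminus W$ then additionally \[\limsup_{t\to\infty}\frac1{b_t}\max_{i_1,\ldots,i_t\in\{0,1\}}\|A_{i_t}\cdots A_{i_1}\|=\infty.\] Furthermore, the subsequence of times along which the limit inferior $\liminf_{t\to\infty}\frac1{a_t}\max_{i_1,\ldots,i_t\in\{0,1\}}\|A_{i_t}\cdots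 A_{i_1}\|=0$ is attained depends only on $\theta$ and not on $(u_1,u_2,v_1,v_2)$: for every $\theta\in\Omega$ there is a strictly increasing sequence of natural numbers $(t_n)_{n=1}^\infty$ such that for every $(u_1,u_2,v_1,v_2)\in\mathbb{R}^4$, with \[A_0=\begin{pmatrix}\lambda&0&u_1\\0&-1&u_2\\0&0&1\end{pmatrix},\qquad A_1=\begin{pmatrix}\cos\theta&-\sin\theta&v_1\\\sin\theta&\cos\theta&v_2\\0&0&1\end{pmatrix},\] \[\lim_{n\to\infty}\frac1{a_{t_n}}\max_{i_1,\ldots,i_{t_n}\in\{0,1\}}\|A_{i_{t_n}}\cdots A_{i_1}\|=0.\]
   Context: $\|\cdot\|$ denotes the Euclidean norm on $\mathbb{R}^d$ and the corresponding operator norm on real $d\times d$ matrices. For a finite set $\mathsf{A}=\{A_0,\ldots,A_{N-1}\}$ of real $d\times d$ matrices, the joint spectral radius is \[\varrho(\mathsf{A}):=\lim_{t\to\infty}\max_{i_1,\ldots,i_t\in\{0,\ldots,N-1\}}\|A_{i_t}\cdots A_{i_1}\|^{1/t}\] (this limit always exists). A $G_\delta$ subset of a metric space is a set which is equal to the intersection of a countable family of open sets; here openness and density are with respect to the metric space $[0,2\pi]$. *)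

theory Defs
  imports "HOL-Analysis.Analysis"
begin

text \<open>The list \<open>[A\<^sub>1, \<dots>, A\<^sub>t]\<close> is sent to \<open>A\<^sub>t ** \<dots> ** A\<^sub>1\<close>: the head of the list acts first.\<close>

primrec word_prod :: "(real^'n^'n) list \<Rightarrow> real^'n^'n" where
  "word_prod [] = mat 1"
| "word_prod (A # As) = word_prod As ** A"

text \<open>Intended for finite nonempty sets of matrices, for which the maximum is over a finite nonempty
  set. A word over the set is the same thing as a choice of indices, up to repetitions in an
  enumeration of the set, which do not affect the maximum.\<close>

definition max_prod_norm :: "(real^'n^'n) set \<Rightarrow> nat \<Rightarrow> real" where
  "max_prod_norm \<A> t = Max {onorm ((*v) (word_prod As)) | As. length As = t \<and> set As \<subseteq> \<A>}"

definition joint_spectral_radius :: "(real^'n^'n) set \<Rightarrow> real" where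
  "joint_spectral_radius \<A> = lim (\<lambda>t. root t (max_prod_norm \<A> t))"

definition mat_A0 :: "real \<Rightarrow> real \<Rightarrow> real \<Rightarrow> real^3^3" where
  "mat_A0 l u1 u2 = vector [vector [l,  0, u1],
                            vector [0, -1, u2],
                            vector [0,  0,  1]]"

definition mat_A1 :: "real \<Rightarrow> real \<Rightarrow> real \<Rightarrow> real^3^3" where
  "mat_A1 \<theta> v1 v2 = vector [vector [cos \<theta>, - sin \<theta>, v1],
                             vector [sin \<theta>,   cos \<theta>, v2],
                             vector [0,       0,        1]]"

end

theory Submission
  imports Defs
begin

text \<open>
  The linear parts of both matrices are nonexpansive, so a product is large only if it moves a point of
  the plane \<open>\<real>\<^sup>2 = \<complex>\<close> far. Taking the fixed point of \<open>A\<^sub>1\<close> as the origin turns the system into the two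
  maps \<open>x \<mapsto> e x\<close> with \<open>e = cis \<theta>\<close>, and \<open>x \<mapsto> (l Re x, - Im x) + w\<close>, where \<open>w\<close> depends linearly
  on the four translation entries. The orbit of \<open>0\<close> under a word depends linearly on \<open>w\<close> and
  continuously on \<open>\<theta>\<close>.

  The growth is governed by the powers of the rotation that map the imaginary axis to itself, the only
  line on which the second map preserves length. If \<open>e\<close> has odd order, these powers are trivial and all
  orbits are bounded (\<open>orbit_bounded_if_odd_order\<close>): both maps leave invariant a disc with caps cut off.
  If some power of \<open>e\<close> is \<open>-1\<close>, this power and the second map act on the imaginary part
  as point reflections at \<open>0\<close> and \<open>Im w / 2\<close>, whose product is a translation by \<open>Im w\<close>, and
  the orbits grow linearly unless \<open>Im w = 0\<close> (\<open>Im_orbit_growth\<close>). Both kinds of angles are dense, and by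
  continuity the behaviour of each persists for any given time in a neighbourhood. Hence, by the
  Baire category theorem, for a dense \<open>G\<^sub>\<delta>\<close> set of angles there are arbitrarily late times at which all
  orbits are small compared to the divergent \<open>a\<close>, and arbitrarily late times at which some orbit is
  large compared to the sublinear \<open>b\<close> (\<open>generic_angles\<close>). By linearity the real and imaginary
  units suffice as test values of \<open>w\<close>, which makes the slow times independent of the translation
  vectors; the exceptional subspace is \<open>Im w = 0\<close>.

  Growth at a rate tending to zero needs no further property of the angle: the maximal orbit length is
  subadditive in time, so by Fekete's argument its rate of growth tends to zero as soon as it is
  arbitrarily small at suitable times (\<open>max_prod_norm_sublinear\<close>), and the slow times are such.
  As the norms are at least \<open>1\<close>, the joint spectral radius is then \<open>1\<close>.
\<close>

section \<open>The planar affine dynamics\<close>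

text \<open>The linear part of \<open>A\<^sub>0\<close>, with \<open>\<real>\<^sup>2\<close> identified with \<open>\<complex>\<close>. It preserves the length of purely imaginary
  numbers only.\<close>

definition contr_reflect :: "real \<Rightarrow> complex \<Rightarrow> complex" where
  "contr_reflect l x = Complex (l * Re x) (- Im x)"

text \<open>In coordinates centred at the fixed point of \<open>A\<^sub>1\<close> the translation part of the system is a single
  complex number \<open>w\<close>, attached to \<open>A\<^sub>0\<close>. The letter \<open>True\<close> stands for \<open>A\<^sub>1\<close>.\<close>

definition step :: "real \<Rightarrow> real \<Rightarrow> complex \<Rightarrow> bool \<Rightarrow> complex \<Rightarrow> complex" where
  "step l \<theta> w b x = (if b then cis \<theta> * x else contr_reflect l x + w)"

abbreviation orbit :: "real \<Rightarrow> real \<Rightarrow> complex \<Rightarrow> bool list \<Rightarrow> complex \<Rightarrow> complex" where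
  "orbit l \<theta> w bs \<equiv> fold (step l \<theta> w) bs"

lemma norm_contr_reflect_le:
  assumes "\<bar>l\<bar> \<le> 1"
  shows "norm (contr_reflect l x) \<le> norm x"
proof -
  have "(l * Re x)\<^sup>2 \<le> 1\<^sup>2 * (Re x)\<^sup>2"
    unfolding power_mult_distrib using assms
    by (intro mult_right_mono) (auto simp: abs_square_le_1)
  then show ?thesis
    by (simp add: contr_reflect_def cmod_def)
qed

lemma contr_reflect_diff: "contr_reflect l x - contr_reflect l y = contr_reflect l (x - y)"
  by (simp add: contr_reflect_def complex_eq_iff algebra_simps)

lemma orbit_nonexpansive:
  assumes "\<bar>l\<bar> \<le> 1"
  shows "norm (orbit l \<theta> w bs x - orbit l \<theta> w bs y) \<le> norm (x - y)"
proof (induction bs arbitrary: x y)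
  case (Cons b bs)
  have "norm (step l \<theta> w b x - step l \<theta> w b y) \<le> norm (x - y)"
    using norm_contr_reflect_le[OF assms, of "x - y"]
    by (simp add: step_def contr_reflect_diff norm_mult flip: right_diff_distrib)
  then show ?case
    using Cons.IH[of "step l \<theta> w b x" "step l \<theta> w b y"] by simp
qed simp

lemma orbit_linear:
  "orbit l \<theta> (r *\<^sub>R w + s *\<^sub>R w') bs (r *\<^sub>R x + s *\<^sub>R x')
     = r *\<^sub>R orbit l \<theta> w bs x + s *\<^sub>R orbit l \<theta> w' bs x'"
proof (induction bs arbitrary: x x')
  case (Cons b bs)
  have "step l \<theta> (r *\<^sub>R w + s *\<^sub>R w') b (r *\<^sub>R x + s *\<^sub>R x')
          = r *\<^sub>R step l \<theta> w b x + s *\<^sub>R step l \<theta> w' b x'"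
    by (simp add: step_def contr_reflect_def complex_eq_iff algebra_simps)
  then show ?case
    using Cons.IH by simp
qed simp

text \<open>Two real numbers are all that an orbit depends on besides the word and the angle, and it does so
  linearly. Estimates for \<open>w = 1\<close> and \<open>w = \<i>\<close> therefore serve all translation vectors at once, which
  makes the set of good angles and the good times independent of the translation vectors.\<close>

lemma orbit_decompose:
  "orbit l \<theta> w bs 0 = Re w *\<^sub>R orbit l \<theta> 1 bs 0 + Im w *\<^sub>R orbit l \<theta> \<i> bs 0"
proof -
  have "w = Re w *\<^sub>R 1 + Im w *\<^sub>R \<i>"
    by (simp add: complex_eq_iff)
  then show ?thesis
    using orbit_linear[of l \<theta> "Re w" 1 "Im w" \<i> bs 0 0] by simp
qed

lemma norm_step_le:
  assumes "\<bar>l\<bar> \<le> 1"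
  shows "norm (step l \<theta> w b x) \<le> norm x + norm w"
  using norm_contr_reflect_le[OF assms, of x] norm_triangle_ineq[of "contr_reflect l x" w]
  by (auto simp: step_def norm_mult)

lemma norm_orbit_le_length:
  assumes "\<bar>l\<bar> \<le> 1"
  shows "norm (orbit l \<theta> w bs x) \<le> norm x + length bs * norm w"
proof (induction bs arbitrary: x)
  case (Cons b bs)
  have "norm (orbit l \<theta> w (b # bs) x) \<le> norm (step l \<theta> w b x) + length bs * norm w"
    using Cons.IH by simp
  also have "\<dots> \<le> norm x + norm w + length bs * norm w"
    using norm_step_le[OF assms] by simp
  finally show ?case
    by (simp add: algebra_simps)
qed simp

text \<open>The second word acts on the end point of the first instead of on \<open>0\<close>; since it is nonexpansive,
  the error is at most the length of that end point. This is the subadditivity behind Fekete's lemma.\<close>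

lemma norm_orbit_append_le:
  assumes "\<bar>l\<bar> \<le> 1"
  shows "norm (orbit l \<theta> w (bs @ cs) 0) \<le> norm (orbit l \<theta> w bs 0) + norm (orbit l \<theta> w cs 0)"
  using orbit_nonexpansive[OF assms, of \<theta> w cs "orbit l \<theta> w bs 0" 0]
    norm_triangle_sub[of "orbit l \<theta> w cs (orbit l \<theta> w bs 0)" "orbit l \<theta> w cs 0"]
  by simp

text \<open>The upper half of Fekete's lemma: a bound for all words of one length \<open>s\<close> controls the linear
  rate of growth of all words, up to a constant, by cutting them into blocks of length \<open>s\<close>.\<close>

lemma norm_orbit_le_blocks:
  assumes "\<bar>l\<bar> \<le> 1" and "s > 0"
    and B: "\<And>cs. length cs = s \<Longrightarrow> norm (orbit l \<theta> w cs 0) \<le> B"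
  shows "norm (orbit l \<theta> w bs 0) \<le> length bs / s * B + s * norm w"
proof (induction "length bs" arbitrary: bs rule: less_induct)
  case less
  have "0 \<le> B"
    using B[of "replicate s True"] by (meson length_replicate norm_ge_zero order.trans)
  show ?case
  proof (cases "length bs < s")
    case True
    have "norm (orbit l \<theta> w bs 0) \<le> length bs * norm w"
      using norm_orbit_le_length[OF assms(1), of \<theta> w bs 0] by simp
    also have "\<dots> \<le> s * norm w"
      using True by (intro mult_right_mono) auto
    finally show ?thesis
      using \<open>0 \<le> B\<close> by (simp add: add_increasing)
  next
    case False
    have "norm (orbit l \<theta> w bs 0)
            \<le> norm (orbit l \<theta> w (take s bs) 0) + norm (orbit l \<theta> w (drop s bs) 0)"
      using norm_orbit_append_le[OF assms(1), of \<theta> w "take s bs" "drop s bs"] by simp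
    also have "\<dots> \<le> B + (length (drop s bs) / s * B + s * norm w)"
      using False \<open>s > 0\<close> by (intro add_mono B less) auto
    also have "\<dots> = length bs / s * B + s * norm w"
      using False \<open>s > 0\<close> by (simp add: of_nat_diff field_simps)
    finally show ?thesis .
  qed
qed

lemma continuous_on_orbit: "continuous_on UNIV (\<lambda>\<theta>. orbit l \<theta> w bs x)"
proof -
  have "continuous_on UNIV (\<lambda>\<theta>. orbit l \<theta> w bs (f \<theta>))" if "continuous_on UNIV f" for f
    using that
  proof (induction bs arbitrary: f)
    case (Cons b bs)
    have "continuous_on UNIV (\<lambda>\<theta>. step l \<theta> w b (f \<theta>))"
    proof (cases b)
      case True
      then show ?thesis
        using Cons.prems unfolding step_def cis_conv_exp
        by (auto intro!: continuous_intros)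
    next
      case False
      then show ?thesis
        using Cons.prems unfolding step_def contr_reflect_def Complex_eq
        by (auto intro!: continuous_intros)
    qed
    then show ?case
      using Cons.IH by simp
  qed simp
  then show ?thesis
    by simp
qed

section \<open>Bounded orbits at rotations of odd order\<close>

text \<open>Among the powers of \<open>e\<close> only \<open>\<plusminus>1\<close> are real, and oddness of \<open>q\<close> excludes \<open>-1\<close>: it would give
  \<open>(-1)\<^sup>q = 1\<close>. There are finitely many powers, so the others stay away from the real axis.\<close>

lemma roots_of_unity_gap:
  fixes e :: complex
  assumes "e ^ q = 1" and "odd q"
  shows "\<exists>\<beta>>0. \<forall>k. e ^ k = 1 \<or> \<beta> \<le> (Im (e ^ k))\<^sup>2"
proof -
  have q: "q > 0"
    using \<open>odd q\<close> by (rule odd_pos)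
  have "norm e = 1"
    using power_eq_imp_eq_base[of "norm e" q 1] \<open>e ^ q = 1\<close> q by (simp flip: norm_power)
  let ?S = "{(Im (e ^ k))\<^sup>2 | k. k < q \<and> e ^ k \<noteq> 1}"
  have pos: "0 < (Im (e ^ k))\<^sup>2" if "e ^ k \<noteq> 1" for k
  proof (rule ccontr)
    assume "\<not> ?thesis"
    then have "Im (e ^ k) = 0"
      by simp
    moreover have "cmod (e ^ k) = 1"
      using \<open>norm e = 1\<close> by (simp add: norm_power)
    ultimately have "e ^ k = - 1"
      using that by (auto simp: cmod_eq_Re complex_eq_iff abs_if split: if_splits)
    then have "(e ^ q) ^ k = - 1"
      using \<open>odd q\<close> by (metis power_mult mult.commute power_minus_odd power_one)
    then show False
      using \<open>e ^ q = 1\<close> by simp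
  qed
  have mod: "e ^ k = e ^ (k mod q)" for k
  proof -
    have "e ^ k = (e ^ q) ^ (k div q) * e ^ (k mod q)"
      by (simp flip: power_mult power_add)
    then show ?thesis
      using \<open>e ^ q = 1\<close> by simp
  qed
  have fin: "finite ?S"
    by simp
  define \<beta> where "\<beta> = Min (insert 1 ?S)"
  have "\<beta> > 0"
    using pos fin by (auto simp: \<beta>_def)
  moreover have "e ^ k = 1 \<or> \<beta> \<le> (Im (e ^ k))\<^sup>2" for k
  proof (cases "e ^ k = 1")
    case False
    then have "(Im (e ^ k))\<^sup>2 \<in> ?S"
      using mod[of k] q by (smt (verit) mem_Collect_eq mod_less_divisor)
    then show ?thesis
      using fin by (simp add: \<beta>_def)
  qed simp
  ultimately show ?thesis
    by blast
qed

text \<open>With \<open>e = cis \<theta>\<close>, for large \<open>r\<close> and suitable \<open>\<eta> < 1\<close> the set \<open>K\<close> of all \<open>x\<close> with \<open>\<bar>x\<bar> \<le> r\<close> and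
  \<open>\<bar>Im (e\<^sup>k x) - Im w / 2\<bar> \<le> \<eta> r\<close> for all \<open>k\<close> is mapped into itself by both maps. It is a disc with
  caps cut off in the directions in which the length could be preserved, that is, the rotations of the
  imaginary axis. The rotation permutes the strips. The reflection \<open>y \<mapsto> Im w - y\<close> of the imaginary
  part preserves the strip with \<open>e\<^sup>k = 1\<close>, because its centre line is at \<open>Im w / 2\<close>. The other
  conditions hold for the image with room to spare: the strips with \<open>e\<^sup>k \<noteq> 1\<close> because \<open>e\<^sup>k\<close> then has
  an imaginary part bounded away from \<open>0\<close> and \<open>\<bar>l\<bar> < 1\<close>, the disc because points
  near the imaginary axis and the circle have been cut off. For large \<open>r\<close> this room exceeds the
  bounded displacement \<open>w\<close>.\<close>

lemma orbit_bounded_if_odd_order: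
  assumes l: "\<bar>l\<bar> < 1" and "cis \<theta> ^ q = 1" and "odd q"
  shows "\<exists>r. \<forall>bs. norm (orbit l \<theta> w bs 0) \<le> r"
proof -
  define e where "e = cis \<theta>"
  obtain \<beta> where "\<beta> > 0" and gap: "\<And>k. e ^ k = 1 \<or> \<beta> \<le> (Im (e ^ k))\<^sup>2"
    using roots_of_unity_gap[of e q] assms unfolding e_def by blast
  have e1: "norm e = 1"
    by (simp add: e_def)
  have l2: "0 < 1 - l\<^sup>2"
    using l by (simp add: abs_square_less_1)
  \<comment> \<open>\<open>\<kappa> r\<close> bounds \<open>Im (e\<^sup>k y)\<close> over the image \<open>y\<close> of the disc under the linear part when \<open>e\<^sup>k \<noteq> 1\<close>;
     \<open>\<zeta> r\<close> is the height of the truncated disc about the real axis, which exceeds \<open>\<eta> r\<close> since the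
     strip is not centred; \<open>\<rho> r\<close> bounds the length of the image of a point below that height.\<close>
  define \<kappa> where "\<kappa> = sqrt (max 0 (1 - (1 - l\<^sup>2) * \<beta>))"
  have "0 \<le> \<kappa>" "\<kappa> < 1"
    using l2 \<open>\<beta> > 0\<close> by (auto simp: \<kappa>_def)
  define \<eta> where "\<eta> = (1 + \<kappa>) / 2"
  have \<eta>: "\<kappa> < \<eta>" "0 < \<eta>" "\<eta> < 1"
    using \<open>0 \<le> \<kappa>\<close> \<open>\<kappa> < 1\<close> by (auto simp: \<eta>_def)
  define \<zeta> where "\<zeta> = (1 + \<eta>) / 2"
  have \<zeta>: "\<eta> < \<zeta>" "0 < \<zeta>" "\<zeta> < 1"
    using \<eta> by (auto simp: \<zeta>_def)
  define \<rho> where "\<rho> = sqrt (l\<^sup>2 + (1 - l\<^sup>2) * \<zeta>\<^sup>2)"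
  have "\<zeta>\<^sup>2 < 1"
    using \<zeta> by (simp add: abs_square_less_1)
  then have "(1 - l\<^sup>2) * \<zeta>\<^sup>2 < (1 - l\<^sup>2) * 1"
    using l2 by (intro mult_strict_left_mono)
  then have "\<rho> < 1"
    by (simp add: \<rho>_def)
  have "0 \<le> \<rho>" and \<rho>2: "\<rho>\<^sup>2 = l\<^sup>2 + (1 - l\<^sup>2) * \<zeta>\<^sup>2"
    using l2 by (simp_all add: \<rho>_def)
  define \<delta> where "\<delta> = Min {\<eta> - \<kappa>, \<zeta> - \<eta>, 1 - \<rho>, \<eta>}"
  have "\<delta> > 0"
    using \<eta> \<zeta> \<open>\<rho> < 1\<close> by (simp add: \<delta>_def)
  define r where "r = 2 * norm w / \<delta>"
  have "0 \<le> r"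
    using \<open>\<delta> > 0\<close> by (simp add: r_def)
  have r_large: "2 * norm w \<le> d * r" if "d \<in> {\<eta> - \<kappa>, \<zeta> - \<eta>, 1 - \<rho>, \<eta>}" for d
  proof -
    have "\<delta> \<le> d"
      unfolding \<delta>_def using that by (intro Min_le) auto
    then have "\<delta> * r \<le> d * r"
      using \<open>0 \<le> r\<close> by (rule mult_right_mono)
    then show ?thesis
      using \<open>\<delta> > 0\<close> by (simp add: r_def)
  qed
  define K where "K = {x. norm x \<le> r \<and> (\<forall>k. \<bar>Im (e ^ k * x) - Im w / 2\<bar> \<le> \<eta> * r)}"
  have w: "\<bar>Im w\<bar> \<le> norm w"
    by (rule abs_Im_le_cmod)
  have zero_K: "0 \<in> K"
    using r_large[of \<eta>] w \<open>0 \<le> r\<close> by (simp add: K_def)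
  have step_K: "step l \<theta> w b x \<in> K" if x: "x \<in> K" for b x
  proof (cases b)
    case True
    have "\<bar>Im (e ^ k * (e * x)) - Im w / 2\<bar> \<le> \<eta> * r" for k
    proof -
      have "\<bar>Im (e ^ Suc k * x) - Im w / 2\<bar> \<le> \<eta> * r"
        using x unfolding K_def by blast
      then show ?thesis
        by (simp only: power_Suc2 mult.assoc)
    qed
    moreover have "norm (e * x) \<le> r"
      using x by (simp add: K_def norm_mult e1)
    ultimately show ?thesis
      using True by (simp add: step_def K_def flip: e_def del: times_complex.sel)
  next
    case False
    define y where "y = contr_reflect l x"
    have step: "step l \<theta> w b x = y + w"
      using False by (simp add: step_def y_def)
    have normx: "norm x \<le> r" and Imx: "\<bar>Im x - Im w / 2\<bar> \<le> \<eta> * r"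
      using x by (auto simp: K_def dest: spec[of _ 0])
    have sq: "(Re x)\<^sup>2 + (Im x)\<^sup>2 \<le> r\<^sup>2"
      using normx by (metis cmod_power2 norm_ge_zero power_mono)
    have "\<bar>Im x\<bar> \<le> \<zeta> * r"
      using Imx w r_large[of "\<zeta> - \<eta>"] by (simp add: algebra_simps)
    then have Imx2: "(Im x)\<^sup>2 \<le> (\<zeta> * r)\<^sup>2"
      by (metis abs_ge_zero power2_abs power_mono)
    \<comment> \<open>The linear part shrinks the horizontal share of the length, and the vertical share is limited by \<open>\<zeta> r\<close>.\<close>
    have "(norm y)\<^sup>2 = l\<^sup>2 * ((Re x)\<^sup>2 + (Im x)\<^sup>2) + (1 - l\<^sup>2) * (Im x)\<^sup>2"
      by (simp add: y_def contr_reflect_def cmod_power2 power_mult_distrib algebra_simps)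
    also have "\<dots> \<le> l\<^sup>2 * r\<^sup>2 + (1 - l\<^sup>2) * (\<zeta> * r)\<^sup>2"
      using sq Imx2 l2 by (intro add_mono mult_left_mono) auto
    also have "\<dots> = (\<rho> * r)\<^sup>2"
      by (simp add: \<rho>2 power_mult_distrib algebra_simps)
    finally have "norm y \<le> \<rho> * r"
      by (rule power2_le_imp_le) (simp add: \<open>0 \<le> r\<close> \<open>0 \<le> \<rho>\<close>)
    then have "norm (y + w) \<le> r"
      using norm_triangle_ineq[of y w] r_large[of "1 - \<rho>"] norm_ge_zero[of w]
      unfolding left_diff_distrib by (smt (verit) insertCI mult_1)
    moreover have "\<bar>Im (e ^ k * (y + w)) - Im w / 2\<bar> \<le> \<eta> * r" for k
    proof (cases "e ^ k = 1")
      case True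
      then show ?thesis
        using Imx by (simp add: y_def contr_reflect_def abs_if split: if_splits)
    next
      case False
      define c where "c = Re (e ^ k)"
      define s where "s = Im (e ^ k)"
      have cs: "c\<^sup>2 = 1 - s\<^sup>2"
        using cmod_power2[of "e ^ k"] e1 by (simp add: c_def s_def norm_power)
      have "\<beta> \<le> s\<^sup>2"
        using gap[of k] False by (simp add: s_def)
      then have "(1 - l\<^sup>2) * \<beta> \<le> (1 - l\<^sup>2) * s\<^sup>2"
        using l2 by (intro mult_left_mono) auto
      then have "(s * l)\<^sup>2 + c\<^sup>2 \<le> \<kappa>\<^sup>2"
        by (simp add: \<kappa>_def cs power_mult_distrib algebra_simps)
      \<comment> \<open>Cauchy-Schwarz in the two coordinates of \<open>x\<close>.\<close>
      have "(Im (e ^ k * y))\<^sup>2 = (s * l * Re x - c * Im x)\<^sup>2"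
        by (simp add: y_def contr_reflect_def c_def s_def algebra_simps)
      also have "\<dots> \<le> ((s * l)\<^sup>2 + c\<^sup>2) * ((Re x)\<^sup>2 + (Im x)\<^sup>2)"
        using zero_le_power2[of "s * l * Im x + c * Re x"]
        by (simp add: power2_eq_square algebra_simps)
      also have "\<dots> \<le> \<kappa>\<^sup>2 * r\<^sup>2"
        using sq \<open>(s * l)\<^sup>2 + c\<^sup>2 \<le> \<kappa>\<^sup>2\<close> by (intro mult_mono) auto
      finally have "\<bar>Im (e ^ k * y)\<bar> \<le> \<kappa> * r"
        using abs_le_square_iff[of "Im (e ^ k * y)" "\<kappa> * r"] \<open>0 \<le> \<kappa>\<close> \<open>0 \<le> r\<close>
        by (simp add: power_mult_distrib del: times_complex.sel)
      moreover have "\<bar>Im (e ^ k * w)\<bar> \<le> norm w"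
        using abs_Im_le_cmod[of "e ^ k * w"] e1 by (simp add: norm_mult norm_power del: times_complex.sel)
      moreover have "Im (e ^ k * (y + w)) = Im (e ^ k * y) + Im (e ^ k * w)"
        by (simp add: distrib_left del: times_complex.sel)
      ultimately show ?thesis
        using w r_large[of "\<eta> - \<kappa>"] by (simp add: algebra_simps del: times_complex.sel)
    qed
    ultimately show ?thesis
      by (simp add: step K_def)
  qed
  have "x \<in> K \<Longrightarrow> orbit l \<theta> w bs x \<in> K" for bs x
    by (induction bs arbitrary: x) (simp_all add: step_K)
  then have "orbit l \<theta> w bs 0 \<in> K" for bs
    using zero_K by blast
  then show ?thesis
    by (auto simp: K_def)
qed

section \<open>Linear growth at rotations having a power equal to -1\<close>

lemma orbit_replicate_True: "orbit l \<theta> w (replicate h True) x = cis \<theta> ^ h * x"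
  by (induction h arbitrary: x) (simp_all add: step_def mult_ac del: fold_replicate)

text \<open>If a power of the rotation is \<open>-1\<close>, it composes with \<open>A\<^sub>0\<close> to a map that acts on the imaginary
  part by \<open>y \<mapsto> - y \<mapsto> y + Im w\<close>, the product of two point reflections of a line. Repeating it
  gives linear growth.\<close>

lemma Im_orbit_growth:
  assumes "cis \<theta> ^ h = - 1"
  shows "Im (orbit l \<theta> w (concat (replicate k (replicate h True @ [False]))) x)
           = Im x + real k * Im w"
proof (induction k arbitrary: x)
  case (Suc k)
  have "orbit l \<theta> w (replicate h True @ [False]) x = contr_reflect l (- x) + w"
    by (simp add: orbit_replicate_True assms step_def del: fold_replicate)
  then have "Im (orbit l \<theta> w (replicate h True @ [False]) x) = Im x + Im w"
    by (simp add: contr_reflect_def)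
  then show ?case
    using Suc by (simp add: algebra_simps)
qed simp

section \<open>From matrix products to planar orbits\<close>

text \<open>The affine chart on which the matrices act as affine maps of the plane, and the directions on which
  they act by their linear parts.\<close>

definition plane_pt :: "complex \<Rightarrow> real^3" where
  "plane_pt x = vector [Re x, Im x, 1]"

definition plane_dir :: "complex \<Rightarrow> real^3" where
  "plane_dir x = vector [Re x, Im x, 0]"

definition letter_mat :: "real \<Rightarrow> real \<Rightarrow> complex \<Rightarrow> complex \<Rightarrow> bool \<Rightarrow> real^3^3" where
  "letter_mat l \<theta> u v b = (if b then mat_A1 \<theta> (Re v) (Im v) else mat_A0 l (Re u) (Im u))"

lemma norm_plane_dir: "norm (plane_dir x) = norm x"
  by (simp add: plane_dir_def norm_vec_def L2_set_def sum_3 cmod_def)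

lemma norm_plane_pt: "norm (plane_pt x) = sqrt ((norm x)\<^sup>2 + 1)"
  by (simp add: plane_pt_def norm_vec_def L2_set_def sum_3 cmod_power2)

lemma norm_plane_pt_bounds:
  shows "1 \<le> norm (plane_pt x)" and "norm x \<le> norm (plane_pt x)"
    and "norm (plane_pt x) \<le> 1 + norm x"
proof -
  show "norm x \<le> norm (plane_pt x)"
    unfolding norm_plane_pt by (intro real_le_rsqrt) simp
  show "norm (plane_pt x) \<le> 1 + norm x"
    unfolding norm_plane_pt by (intro real_le_lsqrt) (simp_all add: power2_sum)
qed (simp add: norm_plane_pt)

lemma vec3_decompose: "y = plane_dir (Complex (y $ 1) (y $ 2)) + (y $ 3) *\<^sub>R plane_pt 0"
  by (simp add: plane_dir_def plane_pt_def vec_eq_iff forall_3)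

lemma letter_mat_dir: "letter_mat l \<theta> u v b *v plane_dir x = plane_dir (step l \<theta> 0 b x)"
  by (simp add: letter_mat_def mat_A0_def mat_A1_def plane_dir_def step_def contr_reflect_def
      vec_eq_iff forall_3 matrix_vector_mult_def sum_3)

text \<open>Moving the origin to the fixed point \<open>z\<close> of \<open>A\<^sub>1\<close> removes the translation vector of \<open>A\<^sub>1\<close>; what
  is left of both translation vectors is the displacement \<open>w\<close> of \<open>z\<close> under \<open>A\<^sub>0\<close>.\<close>

lemma letter_mat_pt:
  assumes "z = cis \<theta> * z + v" and "w = contr_reflect l z + u - z"
  shows "letter_mat l \<theta> u v b *v plane_pt (x + z) = plane_pt (step l \<theta> w b x + z)"
proof -
  have "plane_pt (step l \<theta> w b x + z)
          = plane_pt (if b then cis \<theta> * (x + z) + v else contr_reflect l (x + z) + u)"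
  proof (cases b)
    case True
    have "cis \<theta> * x + z = cis \<theta> * (x + z) + v"
      using assms(1) by (metis add.assoc distrib_left)
    then show ?thesis
      using True by (simp only: step_def if_True)
  next
    case False
    then show ?thesis
      by (simp add: step_def assms(2) contr_reflect_def plane_pt_def algebra_simps)
  qed
  then show ?thesis
    by (auto simp add: letter_mat_def mat_A0_def mat_A1_def plane_pt_def contr_reflect_def
      vec_eq_iff forall_3 matrix_vector_mult_def sum_3)
qed

lemma word_prod_dir:
  "word_prod (map (letter_mat l \<theta> u v) bs) *v plane_dir x = plane_dir (orbit l \<theta> 0 bs x)"
  by (induction bs arbitrary: x) (simp_all add: letter_mat_dir flip: matrix_vector_mul_assoc)

lemma word_prod_pt:
  assumes "z = cis \<theta> * z + v" and "w = contr_reflect l z + u - z"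
  shows "word_prod (map (letter_mat l \<theta> u v) bs) *v plane_pt (x + z)
           = plane_pt (orbit l \<theta> w bs x + z)"
  by (induction bs arbitrary: x)
    (simp_all add: letter_mat_pt[OF assms] flip: matrix_vector_mul_assoc)

lemma max_prod_norm_eq:
  "max_prod_norm {mat_A0 l (Re u) (Im u), mat_A1 \<theta> (Re v) (Im v)} t
     = Max ((\<lambda>bs. onorm ((*v) (word_prod (map (letter_mat l \<theta> u v) bs)))) ` {bs. length bs = t})"
proof -
  have "{mat_A0 l (Re u) (Im u), mat_A1 \<theta> (Re v) (Im v)} = range (letter_mat l \<theta> u v)"
    by (auto simp: letter_mat_def UNIV_bool)
  then have "set As \<subseteq> {mat_A0 l (Re u) (Im u), mat_A1 \<theta> (Re v) (Im v)}
          \<longleftrightarrow> (\<exists>bs. As = map (letter_mat l \<theta> u v) bs)" for As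
    by (simp add: ex_map_conv) blast
  then show ?thesis
    unfolding max_prod_norm_def by (intro arg_cong[of _ _ Max]) auto
qed

lemma finite_bool_lists: "finite {bs :: bool list. length bs = t}"
  using finite_lists_length_eq[of "UNIV :: bool set" t] by simp

lemma onorm_le_max_prod_norm:
  "onorm ((*v) (word_prod (map (letter_mat l \<theta> u v) bs)))
     \<le> max_prod_norm {mat_A0 l (Re u) (Im u), mat_A1 \<theta> (Re v) (Im v)} (length bs)"
  unfolding max_prod_norm_eq by (intro Max_ge) (auto simp: finite_bool_lists)

text \<open>Evaluating a product at the fixed point of \<open>A\<^sub>1\<close> reads off the orbit of the origin in the centred
  coordinates.\<close>

lemma norm_orbit_le_max_prod_norm:
  assumes "z = cis \<theta> * z + v" and "w = contr_reflect l z + u - z"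
  shows "norm (orbit l \<theta> w bs 0) - norm z
     \<le> (1 + norm z) * max_prod_norm {mat_A0 l (Re u) (Im u), mat_A1 \<theta> (Re v) (Im v)} (length bs)"
proof -
  let ?P = "word_prod (map (letter_mat l \<theta> u v) bs)"
  have "norm (orbit l \<theta> w bs 0) - norm z \<le> norm (orbit l \<theta> w bs 0 + z)"
    using norm_diff_ineq[of "orbit l \<theta> w bs 0" z] by simp
  also have "\<dots> \<le> norm (?P *v plane_pt z)"
    using word_prod_pt[OF assms, of bs 0] norm_plane_pt_bounds(2) by simp
  also have "\<dots> \<le> onorm ((*v) ?P) * norm (plane_pt z)"
    by (intro onorm matrix_vector_mul_bounded_linear)
  also have "\<dots> \<le> max_prod_norm {mat_A0 l (Re u) (Im u), mat_A1 \<theta> (Re v) (Im v)} (length bs)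
                   * (1 + norm z)"
    using onorm_le_max_prod_norm norm_plane_pt_bounds(3) onorm_pos_le[of "(*v) ?P"]
    by (intro mult_mono) (auto intro: order.trans matrix_vector_mul_bounded_linear)
  finally show ?thesis
    by (simp add: mult.commute)
qed

text \<open>The last coordinate of a product applied to \<open>plane_pt 0\<close> is \<open>1\<close>.\<close>

lemma one_le_max_prod_norm:
  assumes "z = cis \<theta> * z + v"
  shows "1 \<le> max_prod_norm {mat_A0 l (Re u) (Im u), mat_A1 \<theta> (Re v) (Im v)} t"
proof -
  define bs where "bs = replicate t True"
  let ?P = "word_prod (map (letter_mat l \<theta> u v) bs)"
  have "1 \<le> norm (?P *v plane_pt 0)"
    using word_prod_pt[OF assms refl, of l u bs "- z"] norm_plane_pt_bounds(1) by simp
  also have "\<dots> \<le> onorm ((*v) ?P) * norm (plane_pt 0)"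
    by (intro onorm matrix_vector_mul_bounded_linear)
  also have "\<dots> = onorm ((*v) ?P)"
    by (simp add: norm_plane_pt)
  also have "\<dots> \<le> max_prod_norm {mat_A0 l (Re u) (Im u), mat_A1 \<theta> (Re v) (Im v)} (length bs)"
    by (rule onorm_le_max_prod_norm)
  finally show ?thesis
    by (simp add: bs_def)
qed

text \<open>The linear part of a product is nonexpansive, so only the image of the origin of the plane can make
  its norm large. In centred coordinates that origin is \<open>-z\<close>, whose orbit stays within distance
  \<open>\<bar>z\<bar>\<close> of the orbit of \<open>0\<close>.\<close>

lemma max_prod_norm_le_orbit:
  assumes "\<bar>l\<bar> \<le> 1"
    and "z = cis \<theta> * z + v" and "w = contr_reflect l z + u - z"
    and B: "\<And>bs. length bs = t \<Longrightarrow> norm (orbit l \<theta> w bs 0) \<le> B"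
  shows "max_prod_norm {mat_A0 l (Re u) (Im u), mat_A1 \<theta> (Re v) (Im v)} t \<le> 2 + 2 * norm z + B"
proof -
  have "onorm ((*v) (word_prod (map (letter_mat l \<theta> u v) bs))) \<le> 2 + 2 * norm z + B"
    if bs: "length bs = t" for bs
  proof (rule onorm_le)
    fix y :: "real^3"
    let ?P = "word_prod (map (letter_mat l \<theta> u v) bs)"
    let ?h = "Complex (y $ 1) (y $ 2)"
    have "(y $ 1)\<^sup>2 + (y $ 2)\<^sup>2 \<le> (y $ 1)\<^sup>2 + (y $ 2)\<^sup>2 + (y $ 3)\<^sup>2"
      by simp
    then have h: "norm ?h \<le> norm y"
      by (simp add: cmod_def norm_vec_def L2_set_def sum_3)
    have dir: "norm (orbit l \<theta> 0 bs ?h) \<le> norm ?h"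
      using norm_orbit_le_length[OF assms(1), of \<theta> 0 bs ?h] by simp
    have "norm (orbit l \<theta> w bs (- z)) \<le> norm (orbit l \<theta> w bs 0) + norm z"
      using orbit_nonexpansive[OF assms(1), of \<theta> w bs "- z" 0]
        norm_triangle_sub[of "orbit l \<theta> w bs (- z)" "orbit l \<theta> w bs 0"] by simp
    then have "norm (orbit l \<theta> w bs (- z) + z) \<le> B + 2 * norm z"
      using B[OF bs] norm_triangle_ineq[of "orbit l \<theta> w bs (- z)" z] by linarith
    then have pt: "norm (?P *v plane_pt 0) \<le> 1 + (B + 2 * norm z)"
      using word_prod_pt[OF assms(2,3), of bs "- z"]
        norm_plane_pt_bounds(3)[of "orbit l \<theta> w bs (- z) + z"] by simp
    have "?P *v y = ?P *v plane_dir ?h + (y $ 3) *\<^sub>R (?P *v plane_pt 0)"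
      by (subst vec3_decompose[of y])
        (simp add: matrix_vector_right_distrib matrix_vector_mult_scaleR)
    then have "norm (?P *v y) \<le> norm (plane_dir (orbit l \<theta> 0 bs ?h)) + norm ((y $ 3) *\<^sub>R (?P *v plane_pt 0))"
      by (simp only: word_prod_dir norm_triangle_ineq)
    also have "\<dots> \<le> norm y + norm y * (1 + (B + 2 * norm z))"
      unfolding norm_scaleR norm_plane_dir real_norm_def
      using dir h pt component_le_norm_cart[of y 3]
      by (intro add_mono mult_mono) auto
    finally show "norm (?P *v y) \<le> (2 + 2 * norm z + B) * norm y"
      by (simp add: algebra_simps)
  qed
  moreover have "{bs :: bool list. length bs = t} \<noteq> {}"
    using Ex_list_of_length[of t] by auto
  ultimately show ?thesis
    unfolding max_prod_norm_eq by (subst Max_le_iff) (auto simp: finite_bool_lists)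
qed

lemma joint_spectral_radius_eq_1:
  assumes ge1: "\<And>t. 1 \<le> max_prod_norm \<A> t"
    and sublinear: "(\<lambda>t. max_prod_norm \<A> t / real t) \<longlonglongrightarrow> 0"
  shows "joint_spectral_radius \<A> = 1"
proof -
  have "\<forall>\<^sub>F t in sequentially. max_prod_norm \<A> t / real t < 1"
    using order_tendstoD(2)[OF sublinear] by simp
  then have upper: "\<forall>\<^sub>F t in sequentially. root t (max_prod_norm \<A> t) \<le> root t (real t)"
    using eventually_gt_at_top[of 0] by eventually_elim (auto simp: field_simps)
  have "\<forall>\<^sub>F t in sequentially. 1 \<le> root t (max_prod_norm \<A> t)"
    using eventually_gt_at_top[of 0] by eventually_elim (use ge1 in auto)
  then have "(\<lambda>t. root t (max_prod_norm \<A> t)) \<longlonglongrightarrow> 1"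
    using upper by (rule tendsto_sandwich) (auto intro: LIMSEQ_root)
  then show ?thesis
    unfolding joint_spectral_radius_def by (rule limI)
qed

section \<open>Generic angles\<close>

text \<open>The case \<open>c = 0\<close> gives rotations of odd order, the case \<open>c = 1/2\<close> rotations with a power equal to
  \<open>-1\<close>.\<close>

lemma dense_angles_odd_power_eq:
  fixes c :: real
  assumes "0 \<le> c" "c \<le> 1"
  shows "{0..2*pi} \<subseteq> closure {\<theta> \<in> {0<..<2*pi}. \<exists>n. odd n \<and> cis \<theta> ^ n = cis (2 * pi * c)}"
    (is "_ \<subseteq> closure ?S")
proof -
  have "{0<..<2*pi} \<subseteq> closure ?S"
  proof
    fix x :: real
    assume x: "x \<in> {0<..<2*pi}"
    show "x \<in> closure ?S"
      unfolding closure_approachable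
    proof (intro allI impI)
      fix \<epsilon> :: real
      assume "\<epsilon> > 0"
      define \<delta> where "\<delta> = min \<epsilon> (min x (2 * pi - x))"
      have "\<delta> > 0"
        using x \<open>\<epsilon> > 0\<close> by (simp add: \<delta>_def)
      obtain N :: nat where N: "2 * pi / \<delta> < real N"
        using reals_Archimedean2 by blast
      define n where "n = 2 * N + 1"
      have n: "odd n" "n > 0" "2 * pi / \<delta> < real n"
        using N by (auto simp: n_def)
      define p where "p = \<lfloor>real n * x / (2 * pi)\<rfloor>"
      define \<theta> where "\<theta> = 2 * pi * (real_of_int p + c) / real n"
      have "x - \<theta> = (2 * pi / real n) * (real n * x / (2 * pi) - (real_of_int p + c))"
        using n by (simp add: \<theta>_def field_simps)
      moreover have "\<bar>real n * x / (2 * pi) - (real_of_int p + c)\<bar> \<le> 1"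
        using assms unfolding p_def by linarith
      ultimately have "\<bar>x - \<theta>\<bar> \<le> (2 * pi / real n) * 1"
        by (simp only: abs_mult) (intro mult_mono, auto)
      also have "\<dots> < \<delta>"
        using n \<open>\<delta> > 0\<close> by (simp add: field_simps)
      finally have close: "\<bar>x - \<theta>\<bar> < \<delta>" .
      have "real n * \<theta> = 2 * pi * real_of_int p + 2 * pi * c"
        using n by (simp add: \<theta>_def field_simps)
      then have "cis \<theta> ^ n = cis (2 * pi * real_of_int p) * cis (2 * pi * c)"
        by (simp only: Complex.DeMoivre cis_mult)
      then have "cis \<theta> ^ n = cis (2 * pi * c)"
        by simp
      moreover have "\<theta> \<in> {0<..<2*pi}"
        using close unfolding \<delta>_def by auto
      ultimately have "\<theta> \<in> ?S"
        using n by blast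
      moreover have "dist \<theta> x < \<epsilon>"
        using close unfolding \<delta>_def by (simp add: dist_real_def abs_minus_commute)
      ultimately show "\<exists>y\<in>?S. dist y x < \<epsilon>"
        by blast
    qed
  qed
  then have "closure {0<..<2*pi} \<subseteq> closure ?S"
    by (rule closure_minimal) simp
  then show ?thesis
    by simp
qed

text \<open>Angles at which, at some time past \<open>m\<close>, all orbits are small compared to \<open>a\<close>. The condition is a
  finite system of strict inequalities for each time, hence open.\<close>

definition slow_angles :: "real \<Rightarrow> (nat \<Rightarrow> real) \<Rightarrow> nat \<Rightarrow> real set" where
  "slow_angles l a m = {\<theta> \<in> {0<..<2*pi}. \<exists>t\<ge>m. \<forall>bs. length bs = t \<longrightarrow>
     norm (orbit l \<theta> 1 bs 0) < a t / Suc m \<and> norm (orbit l \<theta> \<i> bs 0) < a t / Suc m}"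

text \<open>Angles at which some word longer than \<open>m\<close> has a large orbit compared to \<open>b\<close>. Its imaginary part
  is to be large for \<open>w = \<i>\<close> and small for \<open>w = 1\<close>, so that by linearity it is large for every \<open>w\<close>
  with \<open>Im w \<noteq> 0\<close>.\<close>

definition fast_angles :: "real \<Rightarrow> (nat \<Rightarrow> real) \<Rightarrow> nat \<Rightarrow> real set" where
  "fast_angles l b m = {\<theta> \<in> {0<..<2*pi}. \<exists>bs. m \<le> length bs \<and>
     \<bar>Im (orbit l \<theta> 1 bs 0)\<bar> < 1 \<and> m * b (length bs) < Im (orbit l \<theta> \<i> bs 0)}"

lemma open_slow_angles: "open (slow_angles l a m)"
proof -
  have "slow_angles l a m = {0<..<2*pi} \<inter> (\<Union>t\<in>{m..}. \<Inter>bs\<in>{bs. length bs = t}.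
      {\<theta>. norm (orbit l \<theta> 1 bs 0) < a t / Suc m} \<inter> {\<theta>. norm (orbit l \<theta> \<i> bs 0) < a t / Suc m})"
    unfolding slow_angles_def by auto
  also have "open \<dots>"
    by (intro open_Int open_UN ballI open_INT finite_bool_lists open_Collect_less
        continuous_intros continuous_on_orbit) auto
  finally show ?thesis .
qed

lemma open_fast_angles: "open (fast_angles l b m)"
proof -
  have "fast_angles l b m = {0<..<2*pi} \<inter> (\<Union>bs\<in>{bs. m \<le> length bs}.
      {\<theta>. \<bar>Im (orbit l \<theta> 1 bs 0)\<bar> < 1} \<inter> {\<theta>. m * b (length bs) < Im (orbit l \<theta> \<i> bs 0)})"
    unfolding fast_angles_def by auto
  also have "open \<dots>"
    by (intro open_Int open_UN ballI open_Collect_less continuous_intros continuous_on_orbit)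
  finally show ?thesis .
qed

text \<open>Bounded orbits are eventually small compared to \<open>a\<close>, which diverges.\<close>

lemma dense_slow_angles:
  assumes "\<bar>l\<bar> < 1" and a_top: "filterlim a at_top sequentially"
  shows "{0..2*pi} \<subseteq> closure (slow_angles l a m)"
proof -
  have "\<theta> \<in> slow_angles l a m"
    if \<theta>: "\<theta> \<in> {0<..<2*pi}" and n: "odd n" "cis \<theta> ^ n = cis (2 * pi * 0)" for \<theta> n
  proof -
    obtain r1 r2 where r: "\<And>bs. norm (orbit l \<theta> 1 bs 0) \<le> r1" "\<And>bs. norm (orbit l \<theta> \<i> bs 0) \<le> r2"
      using orbit_bounded_if_odd_order[OF assms(1) _ n(1), of \<theta>] n(2) by (metis cis_zero mult_zero_right)
    have "\<forall>\<^sub>F t in sequentially. max r1 r2 * Suc m < a t"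
      using a_top unfolding filterlim_at_top_dense by blast
    then have "\<forall>\<^sub>F t in sequentially. t \<ge> m \<and> max r1 r2 * Suc m < a t"
      by (intro eventually_conj eventually_ge_at_top)
    then obtain t where "t \<ge> m" and t: "max r1 r2 * Suc m < a t"
      using eventually_happens'[OF sequentially_bot] by blast
    then have "max r1 r2 < a t / Suc m"
      by (subst pos_less_divide_eq) simp_all
    then have "norm (orbit l \<theta> 1 bs 0) < a t / Suc m" "norm (orbit l \<theta> \<i> bs 0) < a t / Suc m" for bs
      using r(1)[of bs] r(2)[of bs] by linarith+
    then show ?thesis
      unfolding slow_angles_def using \<theta> \<open>t \<ge> m\<close> by blast
  qed
  then have "{\<theta> \<in> {0<..<2*pi}. \<exists>n. odd n \<and> cis \<theta> ^ n = cis (2 * pi * 0)} \<subseteq> slow_angles l a m"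
    by blast
  from closure_mono[OF this] show ?thesis
    by (rule order.trans[OF dense_angles_odd_power_eq, rotated 2]) simp_all
qed

text \<open>Linear growth eventually beats the sublinear \<open>b\<close>.\<close>

lemma dense_fast_angles:
  assumes b_sublinear: "(\<lambda>t. b t / real t) \<longlonglongrightarrow> 0"
  shows "{0..2*pi} \<subseteq> closure (fast_angles l b m)"
proof -
  have "\<theta> \<in> fast_angles l b m"
    if "\<theta> \<in> {0<..<2*pi}" and "cis \<theta> ^ h = cis (2 * pi * (1/2))" for \<theta> h
  proof -
    define wd where "wd k = concat (replicate k (replicate h True @ [False]))" for k
    have len: "length (wd k) = k * Suc h" for k
      by (induction k) (auto simp: wd_def)
    have Im: "Im (orbit l \<theta> w (wd k) 0) = real k * Im w" for k w
      using Im_orbit_growth[of \<theta> h l w k 0] that by (simp add: wd_def)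
    \<comment> \<open>The word \<open>wd k\<close> has length \<open>k (h + 1)\<close> and height \<open>k\<close>, so its height is a fraction \<open>1 / (h + 1)\<close>
       of its length; \<open>\<epsilon>\<close> is small enough to leave room for the factor \<open>m\<close>.\<close>
    define \<epsilon> where "\<epsilon> = 1 / (real (Suc m) * real (Suc h))"
    have "\<epsilon> > 0"
      unfolding \<epsilon>_def by (simp del: of_nat_Suc)
    then have "\<forall>\<^sub>F t in sequentially. b t / real t < \<epsilon>"
      using order_tendstoD(2)[OF b_sublinear] by blast
    then obtain T where T: "\<And>t. t \<ge> T \<Longrightarrow> b t / real t < \<epsilon>"
      unfolding eventually_sequentially by blast
    define k where "k = Suc (max m T)"
    have "k * 1 \<le> k * Suc h"
      by (intro mult_le_mono) auto
    then have k: "m \<le> k * Suc h" "T \<le> k * Suc h" "k > 0"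
      by (auto simp: k_def)
    have "b (k * Suc h) < \<epsilon> * real (k * Suc h)"
      using T[OF k(2)] k(3) by (simp add: pos_divide_less_eq del: mult_Suc_right)
    also have "\<dots> = real k / Suc m"
      by (simp add: \<epsilon>_def del: of_nat_Suc mult_Suc_right)
    finally have bk: "b (k * Suc h) < real k / Suc m" .
    have "real m * b (k * Suc h) \<le> real m * (real k / Suc m)"
      using bk by (intro mult_left_mono) auto
    also have "\<dots> < real k"
      using k(3) by (simp add: field_simps)
    finally have "real m * b (length (wd k)) < Im (orbit l \<theta> \<i> (wd k) 0)"
      using Im len by simp
    moreover have "\<bar>Im (orbit l \<theta> 1 (wd k) 0)\<bar> < 1"
      using Im by simp
    ultimately show ?thesis
      unfolding fast_angles_def using that(1) k(1) len[of k]
      by (metis (mono_tags, lifting) mem_Collect_eq)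
  qed
  then have "{\<theta> \<in> {0<..<2*pi}. \<exists>n. odd n \<and> cis \<theta> ^ n = cis (2 * pi * (1/2))} \<subseteq> fast_angles l b m"
    by blast
  from closure_mono[OF this] show ?thesis
    by (rule order.trans[OF dense_angles_odd_power_eq, rotated 2]) simp_all
qed

lemma generic_angles:
  assumes "\<bar>l\<bar> < 1" and "filterlim a at_top sequentially" and "(\<lambda>t. b t / real t) \<longlonglongrightarrow> 0"
  defines "\<Omega> \<equiv> (\<Inter>m. slow_angles l a m \<inter> fast_angles l b m)"
  shows "gdelta_in (top_of_set {0..2*pi}) \<Omega>"
    and "(top_of_set {0..2*pi}) closure_of \<Omega> = {0..2*pi}"
proof -
  let ?I = "{0..2*pi}"
  define \<G> where "\<G> = range (slow_angles l a) \<union> range (fast_angles l b)"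
  have \<Omega>: "\<Omega> = \<Inter>\<G>"
    by (auto simp: \<Omega>_def \<G>_def)
  have "slow_angles l a m \<subseteq> ?I" "fast_angles l b m \<subseteq> ?I" for m
    by (auto simp: slow_angles_def fast_angles_def)
  then have op: "openin (top_of_set ?I) G" if "G \<in> \<G>" for G
    using that open_slow_angles open_fast_angles
    by (auto simp: \<G>_def openin_open_eq intro!: open_subset)
  moreover have dense: "?I \<subseteq> closure G" if "G \<in> \<G>" for G
    using that dense_slow_angles[OF assms(1,2)] dense_fast_angles[OF assms(3)]
    unfolding \<G>_def by blast
  moreover have "countable \<G>"
    by (simp add: \<G>_def)
  ultimately have "?I \<subseteq> closure \<Omega>"
    unfolding \<Omega> by (intro Baire) auto
  moreover have "\<Omega> \<subseteq> ?I"
    using \<open>slow_angles l a 0 \<subseteq> ?I\<close> unfolding \<Omega>_def by blast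
  ultimately show "(top_of_set ?I) closure_of \<Omega> = ?I"
    by (simp add: closure_of_subtopology Int_absorb1 Int_absorb2)
  show "gdelta_in (top_of_set ?I) \<Omega>"
    unfolding \<Omega>
  proof (rule gdelta_in_Inter)
    show "\<G> \<noteq> {}"
      by (auto simp: \<G>_def)
  qed (auto intro: open_imp_gdelta_in op \<open>countable \<G>\<close>)
qed

section \<open>Growth of the products at a generic angle\<close>

lemma strict_mono_witnesses:
  fixes P :: "nat \<Rightarrow> nat \<Rightarrow> bool"
  assumes ex: "\<And>m. \<exists>t\<ge>m. P m t" and antimono: "\<And>m m' t. m \<le> m' \<Longrightarrow> P m' t \<Longrightarrow> P m t"
  obtains \<tau> where "strict_mono \<tau>" "\<And>n. P n (\<tau> n)"
proof -
  have "\<exists>\<tau>. \<forall>n. P n (\<tau> n) \<and> \<tau> n < \<tau> (Suc n)"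
  proof (rule dependent_nat_choice)
    show "\<exists>t. P 0 t"
      using ex by blast
    show "\<exists>t'. P (Suc n) t' \<and> t < t'" for t n
    proof -
      obtain t' where "t' \<ge> max (Suc n) (Suc t)" "P (max (Suc n) (Suc t)) t'"
        using ex by blast
      then show ?thesis
        using antimono[of "Suc n" "max (Suc n) (Suc t)" t'] by auto
    qed
  qed
  then show thesis
    using that strict_mono_Suc_iff by blast
qed

lemma slow_times:
  assumes a_pos: "\<And>t. t \<ge> 1 \<Longrightarrow> a t > 0" and \<theta>: "\<And>m. \<theta> \<in> slow_angles l a m"
  obtains \<tau> where "strict_mono \<tau>" and "\<And>n. 1 \<le> \<tau> n"
    and "\<And>n w bs. length bs = \<tau> n \<Longrightarrow>
      norm (orbit l \<theta> w bs 0) \<le> (\<bar>Re w\<bar> + \<bar>Im w\<bar>) * (a (\<tau> n) / Suc n)"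
proof -
  define P where "P m t \<longleftrightarrow> 1 \<le> t \<and> (\<forall>bs. length bs = t \<longrightarrow>
    norm (orbit l \<theta> 1 bs 0) \<le> a t / Suc m \<and> norm (orbit l \<theta> \<i> bs 0) \<le> a t / Suc m)" for m t
  have antimono: "P m t" if "m \<le> m'" and P: "P m' t" for m m' t
  proof -
    have le: "a t / Suc m' \<le> a t / Suc m"
      using that a_pos[of t] by (intro divide_left_mono) (auto simp: P_def)
    have "norm (orbit l \<theta> 1 bs 0) \<le> a t / Suc m \<and> norm (orbit l \<theta> \<i> bs 0) \<le> a t / Suc m"
      if "length bs = t" for bs
      using P that order.trans[OF _ le] unfolding P_def by blast
    then show ?thesis
      using P unfolding P_def by blast
  qed
  have ex: "\<exists>t\<ge>m. P m t" for m
  proof -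
    obtain t where "t \<ge> Suc m" and "\<forall>bs. length bs = t \<longrightarrow>
        norm (orbit l \<theta> 1 bs 0) < a t / Suc (Suc m) \<and> norm (orbit l \<theta> \<i> bs 0) < a t / Suc (Suc m)"
      using \<theta>[of "Suc m"] unfolding slow_angles_def by blast
    then have "P (Suc m) t"
      unfolding P_def by (simp add: less_imp_le)
    then show ?thesis
      using antimono[of m "Suc m" t] \<open>t \<ge> Suc m\<close> Suc_leD le_SucI by blast
  qed
  obtain \<tau> where \<tau>: "strict_mono \<tau>" "\<And>n. P n (\<tau> n)"
    by (rule strict_mono_witnesses[of P]) (use ex antimono in blast)+
  show thesis
  proof (rule that[OF \<tau>(1)])
    show "1 \<le> \<tau> n" for n
      using \<tau>(2) by (simp add: P_def)
    fix n w and bs :: "bool list"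
    assume bs: "length bs = \<tau> n"
    have "norm (orbit l \<theta> w bs 0)
            \<le> \<bar>Re w\<bar> * norm (orbit l \<theta> 1 bs 0) + \<bar>Im w\<bar> * norm (orbit l \<theta> \<i> bs 0)"
      unfolding orbit_decompose[of l \<theta> w]
      by (rule order.trans[OF norm_triangle_ineq]) simp
    also have "\<dots> \<le> \<bar>Re w\<bar> * (a (\<tau> n) / Suc n) + \<bar>Im w\<bar> * (a (\<tau> n) / Suc n)"
      using \<tau>(2)[of n] bs unfolding P_def by (intro add_mono mult_left_mono) auto
    finally show "norm (orbit l \<theta> w bs 0) \<le> (\<bar>Re w\<bar> + \<bar>Im w\<bar>) * (a (\<tau> n) / Suc n)"
      by (simp only: distrib_right)
  qed
qed

text \<open>The norm exceeds the orbits by a constant depending on \<open>z\<close>, which is negligible since \<open>a\<close>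
  diverges.\<close>

lemma max_prod_norm_slow:
  assumes "\<bar>l\<bar> \<le> 1"
    and "z = cis \<theta> * z + v" and "w = contr_reflect l z + u - z"
    and a_pos: "\<And>t. t \<ge> 1 \<Longrightarrow> a t > 0" and a_top: "filterlim a at_top sequentially"
    and \<tau>: "strict_mono \<tau>" "\<And>n. 1 \<le> \<tau> n"
    and bound: "\<And>n bs. length bs = \<tau> n \<Longrightarrow> norm (orbit l \<theta> w bs 0) \<le> C * (a (\<tau> n) / Suc n)"
  defines "\<A> \<equiv> {mat_A0 l (Re u) (Im u), mat_A1 \<theta> (Re v) (Im v)}"
  shows "(\<lambda>n. max_prod_norm \<A> (\<tau> n) / a (\<tau> n)) \<longlonglongrightarrow> 0"
proof (rule tendsto_sandwich[OF _ _ tendsto_const])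
  show "\<forall>\<^sub>F n in sequentially. 0 \<le> max_prod_norm \<A> (\<tau> n) / a (\<tau> n)"
    using order.trans[OF zero_le_one one_le_max_prod_norm[OF assms(2)]] a_pos \<tau>(2)
    unfolding \<A>_def by (intro always_eventually allI divide_nonneg_pos) blast+
  have "max_prod_norm \<A> (\<tau> n) / a (\<tau> n) \<le> (2 + 2 * norm z) / a (\<tau> n) + C / Suc n" for n
  proof -
    have "max_prod_norm \<A> (\<tau> n) \<le> 2 + 2 * norm z + C * (a (\<tau> n) / Suc n)"
      unfolding \<A>_def by (rule max_prod_norm_le_orbit[OF assms(1-3) bound])
    then have "max_prod_norm \<A> (\<tau> n) / a (\<tau> n) \<le> (2 + 2 * norm z + C * (a (\<tau> n) / Suc n)) / a (\<tau> n)"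
      using a_pos[OF \<tau>(2)] by (intro divide_right_mono) (auto intro: less_imp_le)
    also have "\<dots> = (2 + 2 * norm z) / a (\<tau> n) + C / Suc n"
      using a_pos[OF \<tau>(2), of n] by (simp add: add_divide_distrib)
    finally show ?thesis .
  qed
  then show "\<forall>\<^sub>F n in sequentially.
      max_prod_norm \<A> (\<tau> n) / a (\<tau> n) \<le> (2 + 2 * norm z) / a (\<tau> n) + C / Suc n"
    by simp
  have a\<tau>: "filterlim (\<lambda>n. a (\<tau> n)) at_top sequentially"
    using a_top filterlim_subseq[OF \<tau>(1)] by (rule filterlim_compose)
  have "(\<lambda>n. (2 + 2 * norm z) / a (\<tau> n) + C / Suc n) \<longlonglongrightarrow> 0 + 0"
    by (intro tendsto_add tendsto_divide_0[OF tendsto_const] LIMSEQ_Suc[OF lim_const_over_n]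
        filterlim_at_top_imp_at_infinity[OF a\<tau>])
  then show "(\<lambda>n. (2 + 2 * norm z) / a (\<tau> n) + C / Suc n) \<longlonglongrightarrow> 0"
    by simp
qed

text \<open>By Fekete's argument a small rate of growth at a single time already bounds the rate at all later
  times.\<close>

lemma max_prod_norm_sublinear:
  assumes "\<bar>l\<bar> \<le> 1"
    and "z = cis \<theta> * z + v" and "w = contr_reflect l z + u - z"
    and slow: "\<And>\<epsilon>. \<epsilon> > 0 \<Longrightarrow> \<exists>s\<ge>1. \<forall>bs. length bs = s \<longrightarrow> norm (orbit l \<theta> w bs 0) \<le> \<epsilon> * real s"
  defines "\<A> \<equiv> {mat_A0 l (Re u) (Im u), mat_A1 \<theta> (Re v) (Im v)}"
  shows "(\<lambda>t. max_prod_norm \<A> t / real t) \<longlonglongrightarrow> 0"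
proof (rule LIMSEQ_I)
  fix \<epsilon> :: real
  assume "\<epsilon> > 0"
  then obtain s where "s \<ge> 1" and s: "\<And>bs. length bs = s \<Longrightarrow> norm (orbit l \<theta> w bs 0) \<le> \<epsilon> / 2 * real s"
    using slow[of "\<epsilon> / 2"] by auto
  define c where "c = 2 + 2 * norm z + real s * norm w"
  obtain T :: nat where T: "2 * c / \<epsilon> < real T"
    using reals_Archimedean2 by blast
  have "norm (max_prod_norm \<A> t / real t) < \<epsilon>" if "t \<ge> Suc T" for t
  proof -
    have "max_prod_norm \<A> t \<le> 2 + 2 * norm z + (t / s * (\<epsilon> / 2 * s) + s * norm w)"
      unfolding \<A>_def
    proof (rule max_prod_norm_le_orbit[OF assms(1-3)])
      show "norm (orbit l \<theta> w bs 0) \<le> t / s * (\<epsilon> / 2 * s) + s * norm w" if "length bs = t" for bs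
        using norm_orbit_le_blocks[OF assms(1), of s \<theta> w "\<epsilon> / 2 * s" bs] s \<open>s \<ge> 1\<close> that by simp
    qed
    also have "\<dots> = c + t * (\<epsilon> / 2)"
      using \<open>s \<ge> 1\<close> by (simp add: c_def)
    also have "\<dots> < \<epsilon> * t"
    proof -
      have "2 * c / \<epsilon> < real t"
        using T that by linarith
      then show ?thesis
        using \<open>\<epsilon> > 0\<close> by (simp add: field_simps)
    qed
    finally have "max_prod_norm \<A> t < \<epsilon> * t" .
    moreover have "1 \<le> max_prod_norm \<A> t"
      unfolding \<A>_def by (rule one_le_max_prod_norm[OF assms(2)])
    ultimately show ?thesis
      using that by (simp add: pos_divide_less_eq)
  qed
  then show "\<exists>T. \<forall>t\<ge>T. norm (max_prod_norm \<A> t / real t - 0) < \<epsilon>"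
    by auto
qed

lemma limsup_max_prod_norm_fast:
  assumes "z = cis \<theta> * z + v" and "w = contr_reflect l z + u - z" and "Im w \<noteq> 0"
    and b_top: "filterlim b at_top sequentially"
    and fast: "\<And>m. \<theta> \<in> fast_angles l b m"
  defines "\<A> \<equiv> {mat_A0 l (Re u) (Im u), mat_A1 \<theta> (Re v) (Im v)}"
  shows "limsup (\<lambda>t. ereal (max_prod_norm \<A> t / b t)) = \<infinity>"
proof (rule ccontr)
  assume "\<not> ?thesis"
  then obtain K where "limsup (\<lambda>t. ereal (max_prod_norm \<A> t / b t)) < ereal K"
    using less_PInf_Ex_of_nat by (metis ereal_infty_less(1))
  then have "\<forall>\<^sub>F t in sequentially. max_prod_norm \<A> t / b t < K"
    by (auto dest: Limsup_lessD)
  moreover have "\<forall>\<^sub>F t in sequentially. 1 \<le> b t"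
    using b_top by (simp add: filterlim_at_top)
  ultimately have "\<forall>\<^sub>F t in sequentially. max_prod_norm \<A> t / b t < K \<and> 1 \<le> b t"
    by (rule eventually_conj)
  then obtain T where T: "\<And>t. t \<ge> T \<Longrightarrow> max_prod_norm \<A> t / b t < K \<and> 1 \<le> b t"
    unfolding eventually_sequentially by blast
  define c where "c = \<bar>Re w\<bar> + norm z"
  \<comment> \<open>If the limit superior were below \<open>K\<close>, dividing the inequalities for the word in \<open>fast_angles\<close> by
     \<open>b\<close> would bound \<open>\<bar>Im w\<bar> m\<close> by \<open>D\<close>, for every large \<open>m\<close>.\<close>
  define D where "D = (1 + norm z) * K + c"
  obtain M :: nat where M: "D / \<bar>Im w\<bar> < real M"
    using reals_Archimedean2 by blast
  define m where "m = max M T"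
  obtain bs where bs: "m \<le> length bs" and small: "\<bar>Im (orbit l \<theta> 1 bs 0)\<bar> < 1"
    and big: "m * b (length bs) < Im (orbit l \<theta> \<i> bs 0)"
    using fast[of m] unfolding fast_angles_def by blast
  let ?t = "length bs"
  have b1: "1 \<le> b ?t" and K: "max_prod_norm \<A> ?t < K * b ?t"
    using T[of ?t] bs by (auto simp: m_def field_simps)
  have "\<bar>Im w\<bar> * (m * b ?t) - \<bar>Re w\<bar> * 1
          \<le> \<bar>Im w\<bar> * \<bar>Im (orbit l \<theta> \<i> bs 0)\<bar> - \<bar>Re w\<bar> * \<bar>Im (orbit l \<theta> 1 bs 0)\<bar>"
    using small big by (intro diff_mono mult_left_mono) auto
  also have "\<dots> \<le> \<bar>Im (orbit l \<theta> w bs 0)\<bar>"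
    unfolding orbit_decompose[of l \<theta> w] by (simp flip: abs_mult)
  also have "\<dots> \<le> norm (orbit l \<theta> w bs 0)"
    by (rule abs_Im_le_cmod)
  also have "\<dots> \<le> (1 + norm z) * max_prod_norm \<A> ?t + norm z"
    using norm_orbit_le_max_prod_norm[OF assms(1,2), of bs] unfolding \<A>_def by simp
  also have "\<dots> \<le> (1 + norm z) * (K * b ?t) + norm z"
    using K by (intro add_mono mult_left_mono) auto
  finally have "\<bar>Im w\<bar> * m * b ?t \<le> (1 + norm z) * K * b ?t + c"
    by (simp add: c_def mult.assoc)
  also have "\<dots> \<le> (1 + norm z) * K * b ?t + c * b ?t"
    using b1 mult_left_mono[of 1 "b ?t" c] by (simp add: c_def)
  also have "\<dots> = D * b ?t"
    by (simp add: D_def distrib_right)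
  finally have "\<bar>Im w\<bar> * m \<le> D"
    using b1 by (simp add: mult_le_cancel_right)
  moreover have "D < \<bar>Im w\<bar> * M"
    using M assms(3) by (simp add: field_simps)
  moreover have "\<bar>Im w\<bar> * M \<le> \<bar>Im w\<bar> * m"
    by (intro mult_left_mono) (auto simp: m_def)
  ultimately show False
    by linarith
qed

text \<open>The vector whose orthogonal complement is the exceptional subspace, on which the displacement \<open>w\<close> has
  zero imaginary part, that is, on which the fixed points of \<open>A\<^sub>0\<close> and \<open>A\<^sub>1\<close> have the same second
  coordinate. The factor \<open>1 - cos \<theta>\<close> clears the denominator of \<open>z\<close>.\<close>

definition drift_normal :: "real \<Rightarrow> real^4" where
  "drift_normal \<theta> = vector [0, 1 - cos \<theta>, - sin \<theta>, - (1 - cos \<theta>)]"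

lemma vector_4_nth:
  "(vector [p, q, r, s] :: real^4) $ 1 = p" "(vector [p, q, r, s] :: real^4) $ 2 = q"
  "(vector [p, q, r, s] :: real^4) $ 3 = r" "(vector [p, q, r, s] :: real^4) $ 4 = s"
  by (simp_all add: vector_def)

lemma fixed_point_rotation:
  fixes u v :: complex
  assumes "cis \<theta> \<noteq> 1"
  defines "z \<equiv> v / (1 - cis \<theta>)"
  shows "z = cis \<theta> * z + v"
    and "drift_normal \<theta> \<bullet> vector [Re u, Im u, Re v, Im v]
           = (1 - cos \<theta>) * Im (contr_reflect l z + u - z)"
proof -
  have "(1 - cis \<theta>) * z = v"
    using assms by (simp add: z_def)
  then show *: "z = cis \<theta> * z + v"
    by (simp add: algebra_simps)
  have re: "Re v = (1 - cos \<theta>) * Re z + sin \<theta> * Im z" and im: "Im v = (1 - cos \<theta>) * Im z - sin \<theta> * Re z"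
    using arg_cong[OF \<open>(1 - cis \<theta>) * z = v\<close>, of Re] arg_cong[OF \<open>(1 - cis \<theta>) * z = v\<close>, of Im] by simp_all
  have "sin \<theta> * Re v + (1 - cos \<theta>) * Im v
          = (sin \<theta> * sin \<theta> + (1 - cos \<theta>) * (1 - cos \<theta>)) * Im z"
    unfolding re im by algebra
  also have "sin \<theta> * sin \<theta> + (1 - cos \<theta>) * (1 - cos \<theta>) = 2 * (1 - cos \<theta>)"
    using sin_cos_squared_add[of \<theta>] by (simp add: power2_eq_square algebra_simps)
  finally show "drift_normal \<theta> \<bullet> vector [Re u, Im u, Re v, Im v]
           = (1 - cos \<theta>) * Im (contr_reflect l z + u - z)"
    by (simp add: drift_normal_def inner_vec_def sum_4 vector_4_nth contr_reflect_def algebra_simps)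
qed

lemma cos_less_1: "\<theta> \<in> {0<..<2*pi} \<Longrightarrow> cos \<theta> < 1"
proof -
  assume \<theta>: "\<theta> \<in> {0<..<2*pi}"
  have "cos \<theta> \<noteq> 1"
  proof
    assume "cos \<theta> = 1"
    then obtain k :: int where k: "\<theta> = of_int k * (2 * pi)"
      unfolding cos_one_2pi_int by (auto simp: mult.assoc)
    then have "0 < of_int k * (2 * pi)" "of_int k * (2 * pi) < 1 * (2 * pi)"
      using \<theta> by auto
    then have "0 < k" "k < 1"
      by (simp_all add: zero_less_mult_iff)
    then show False
      by simp
  qed
  then show ?thesis
    using cos_le_one[of \<theta>] by linarith
qed

theorem theorem1:
  fixes a b :: "nat \<Rightarrow> real" and l :: real
  assumes a_pos: "\<And>t. t \<ge> 1 \<Longrightarrow> a t > 0"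
    and b_pos: "\<And>t. t \<ge> 1 \<Longrightarrow> b t > 0"
    and a_top: "filterlim a at_top sequentially"
    and b_top: "filterlim b at_top sequentially"
    and a_sublinear: "(\<lambda>t. a t / real t) \<longlonglongrightarrow> 0"
    and b_sublinear: "(\<lambda>t. b t / real t) \<longlonglongrightarrow> 0"
    and l: "l \<in> {-1<..<1}"
  shows "\<exists>\<Omega>. gdelta_in (top_of_set {0..2*pi}) \<Omega>
    \<and> (top_of_set {0..2*pi}) closure_of \<Omega> = {0..2*pi}
    \<and> (\<forall>\<theta>\<in>\<Omega>.
        (\<exists>W :: (real^4) set. subspace W \<and> dim W \<le> 3 \<and>
          (\<forall>u1 u2 v1 v2. let \<A> = {mat_A0 l u1 u2, mat_A1 \<theta> v1 v2} in
              joint_spectral_radius \<A> = 1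
            \<and> (\<lambda>t. max_prod_norm \<A> t / real t) \<longlonglongrightarrow> 0
            \<and> liminf (\<lambda>t. ereal (max_prod_norm \<A> t / a t)) = 0
            \<and> (vector [u1, u2, v1, v2] \<notin> W \<longrightarrow>
                 limsup (\<lambda>t. ereal (max_prod_norm \<A> t / b t)) = \<infinity>)))
      \<and> (\<exists>\<tau> :: nat \<Rightarrow> nat. strict_mono \<tau> \<and>
          (\<forall>u1 u2 v1 v2. let \<A> = {mat_A0 l u1 u2, mat_A1 \<theta> v1 v2} in
              (\<lambda>n. max_prod_norm \<A> (\<tau> n) / a (\<tau> n)) \<longlonglongrightarrow> 0)))"
proof -
  have l1: "\<bar>l\<bar> < 1" "\<bar>l\<bar> \<le> 1"
    using l by auto
  define \<Omega> where "\<Omega> = (\<Inter>m. slow_angles l a m \<inter> fast_angles l b m)"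
  have *: "(\<exists>W :: (real^4) set. subspace W \<and> dim W \<le> 3 \<and>
          (\<forall>u1 u2 v1 v2. let \<A> = {mat_A0 l u1 u2, mat_A1 \<theta> v1 v2} in
              joint_spectral_radius \<A> = 1
            \<and> (\<lambda>t. max_prod_norm \<A> t / real t) \<longlonglongrightarrow> 0
            \<and> liminf (\<lambda>t. ereal (max_prod_norm \<A> t / a t)) = 0
            \<and> (vector [u1, u2, v1, v2] \<notin> W \<longrightarrow>
                 limsup (\<lambda>t. ereal (max_prod_norm \<A> t / b t)) = \<infinity>)))
      \<and> (\<exists>\<tau> :: nat \<Rightarrow> nat. strict_mono \<tau> \<and>
          (\<forall>u1 u2 v1 v2. let \<A> = {mat_A0 l u1 u2, mat_A1 \<theta> v1 v2} in
              (\<lambda>n. max_prod_norm \<A> (\<tau> n) / a (\<tau> n)) \<longlonglongrightarrow> 0))"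
    if "\<theta> \<in> \<Omega>" for \<theta>
  proof -
    have slow: "\<theta> \<in> slow_angles l a m" and fast: "\<theta> \<in> fast_angles l b m" for m
      using that by (auto simp: \<Omega>_def)
    have "\<theta> \<in> {0<..<2*pi}"
      using slow[of 0] by (simp add: slow_angles_def)
    then have cos1: "cos \<theta> < 1"
      by (rule cos_less_1)
    then have cis1: "cis \<theta> \<noteq> 1"
      by (auto simp: complex_eq_iff)
    obtain \<tau> where \<tau>: "strict_mono \<tau>" "\<And>n. 1 \<le> \<tau> n"
      and bound: "\<And>n w bs. length bs = \<tau> n \<Longrightarrow>
        norm (orbit l \<theta> w bs 0) \<le> (\<bar>Re w\<bar> + \<bar>Im w\<bar>) * (a (\<tau> n) / Suc n)"
      using slow_times[OF a_pos slow] by blast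
    define W where "W = {x. drift_normal \<theta> \<bullet> x = 0}"
    have "drift_normal \<theta> $ 2 \<noteq> 0"
      using cos1 by (simp add: drift_normal_def vector_4_nth)
    then have "drift_normal \<theta> \<noteq> 0"
      by (metis zero_index)
    then have W: "subspace W" "dim W \<le> 3"
      unfolding W_def by (simp_all add: subspace_hyperplane dim_hyperplane)
    have main: "joint_spectral_radius \<A> = 1
        \<and> (\<lambda>t. max_prod_norm \<A> t / real t) \<longlonglongrightarrow> 0
        \<and> liminf (\<lambda>t. ereal (max_prod_norm \<A> t / a t)) = 0
        \<and> (vector [u1, u2, v1, v2] \<notin> W \<longrightarrow>
             limsup (\<lambda>t. ereal (max_prod_norm \<A> t / b t)) = \<infinity>)
        \<and> (\<lambda>n. max_prod_norm \<A> (\<tau> n) / a (\<tau> n)) \<longlonglongrightarrow> 0"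
      if \<A>: "\<A> = {mat_A0 l u1 u2, mat_A1 \<theta> v1 v2}" for u1 u2 v1 v2 \<A>
    proof -
      define u where "u = Complex u1 u2"
      define v where "v = Complex v1 v2"
      define z where "z = v / (1 - cis \<theta>)"
      define w where "w = contr_reflect l z + u - z"
      have \<A>_eq: "\<A> = {mat_A0 l (Re u) (Im u), mat_A1 \<theta> (Re v) (Im v)}"
        by (simp add: \<A> u_def v_def)
      note z = fixed_point_rotation(1)[OF cis1, of v, folded z_def]
      have ge1: "1 \<le> max_prod_norm \<A> t" for t
        unfolding \<A>_eq by (rule one_le_max_prod_norm[OF z])
      have slow_lim: "(\<lambda>n. max_prod_norm \<A> (\<tau> n) / a (\<tau> n)) \<longlonglongrightarrow> 0"
        unfolding \<A>_eq by (rule max_prod_norm_slow[OF l1(2) z w_def a_pos a_top \<tau> bound])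
      define C where "C = \<bar>Re w\<bar> + \<bar>Im w\<bar>"
      have sublinear: "(\<lambda>t. max_prod_norm \<A> t / real t) \<longlonglongrightarrow> 0"
        unfolding \<A>_eq
      proof (rule max_prod_norm_sublinear[OF l1(2) z w_def])
        fix \<epsilon> :: real
        assume "\<epsilon> > 0"
        \<comment> \<open>Along the slow times the orbits are at most of size \<open>a\<close>, which is sublinear itself.\<close>
        have "(\<lambda>n. C * (a (\<tau> n) / real (\<tau> n))) \<longlonglongrightarrow> C * 0"
          using LIMSEQ_subseq_LIMSEQ[OF a_sublinear \<tau>(1)]
          by (intro tendsto_mult tendsto_const) (simp add: o_def)
        then have "\<forall>\<^sub>F n in sequentially. C * (a (\<tau> n) / real (\<tau> n)) < \<epsilon>"
          using \<open>\<epsilon> > 0\<close> by (intro order_tendstoD(2)) auto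
        then obtain n where n: "C * (a (\<tau> n) / real (\<tau> n)) < \<epsilon>"
          using eventually_happens'[OF sequentially_bot] by blast
        have "norm (orbit l \<theta> w bs 0) \<le> \<epsilon> * real (\<tau> n)" if "length bs = \<tau> n" for bs
        proof -
          have "norm (orbit l \<theta> w bs 0) \<le> C * (a (\<tau> n) / Suc n)"
            using bound[OF that] by (simp add: C_def)
          also have "\<dots> \<le> C * (a (\<tau> n) / 1)"
            using a_pos[OF \<tau>(2)[of n]] by (intro mult_left_mono divide_left_mono) (auto simp: C_def)
          also have "\<dots> \<le> \<epsilon> * real (\<tau> n)"
            using n \<tau>(2)[of n] by (simp add: field_simps)
          finally show ?thesis .
        qed
        then show "\<exists>s\<ge>1. \<forall>bs. length bs = s \<longrightarrow> norm (orbit l \<theta> w bs 0) \<le> \<epsilon> * real s"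
          using \<tau>(2)[of n] by blast
      qed
      have "liminf (\<lambda>t. ereal (max_prod_norm \<A> t / a t)) \<le> liminf ((\<lambda>t. ereal (max_prod_norm \<A> t / a t)) \<circ> \<tau>)"
        by (rule liminf_subseq_mono[OF \<tau>(1)])
      also have "\<dots> = 0"
        using slow_lim
        by (intro lim_imp_Liminf) (auto simp: o_def zero_ereal_def)
      finally have "liminf (\<lambda>t. ereal (max_prod_norm \<A> t / a t)) \<le> 0" .
      moreover have "0 \<le> liminf (\<lambda>t. ereal (max_prod_norm \<A> t / a t))"
      proof (rule Liminf_bounded)
        show "\<forall>\<^sub>F t in sequentially. 0 \<le> ereal (max_prod_norm \<A> t / a t)"
          using eventually_ge_at_top[of 1]
        proof eventually_elim
          case (elim t)
          then show ?case
            using a_pos[of t] ge1[of t] by simp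
        qed
      qed
      ultimately have liminf: "liminf (\<lambda>t. ereal (max_prod_norm \<A> t / a t)) = 0"
        by (rule antisym)
      have limsup: "limsup (\<lambda>t. ereal (max_prod_norm \<A> t / b t)) = \<infinity>"
        if "vector [u1, u2, v1, v2] \<notin> W"
      proof -
        have "Im w \<noteq> 0"
          using that fixed_point_rotation(2)[OF cis1, of u v l]
          by (auto simp: W_def w_def z_def u_def v_def)
        then show ?thesis
          unfolding \<A>_eq by (rule limsup_max_prod_norm_fast[OF z w_def _ b_top fast])
      qed
      show ?thesis
        using joint_spectral_radius_eq_1[OF ge1 sublinear] sublinear liminf limsup slow_lim by blast
    qed
    show ?thesis
      unfolding Let_def using W \<tau>(1) main[OF refl] by blast
  qed
  show ?thesis
    using generic_angles[OF l1(1) a_top b_sublinear] * unfolding \<Omega>_def[symmetric] by blast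
qed

end
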